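(* Let $\alpha>0$ be a constant, $m=\alpha n$, and let $H$ be an $m\times n$ random matrix with i.i.d. standard normal entries. Define $\hat{\mathbf{x}}_1=1$, $r_1^{(neg)}=\|H_{:,1}\|_2^2$, and for $2\le k\le n$ recursively $$\hat{\mathbf{x}}_k=\operatorname*{argmin}_{\mathbf{x}_k\in\{-1,1\}}\left\|H_{:,1:k}\begin{bmatrix}\hat{\mathbf{x}}_{1:k-1}\\ \mathbf{x}_k\end{bmatrix}\right\|_2^2,\qquad r_k^{(neg)}=\|H_{:,1:k}\hat{\mathbf{x}}_{1:k}\|_2^2 .$$ Then for every $2\le k\le n$, $$E r_k^{(neg)}=E r_{k-1}^{(neg)}-2\sqrt{\tfrac{2}{\pi}}\,E\sqrt{r_{k-1}^{(neg)}}+m .$$ Moreover, assume that the $r_k^{(neg)}$ concentrate around their means for $k$ proportional to $n$, in the sense that for every $c\in(0,1]$ and $k=\lceil cn\rceil$ one has $\lim_{n\to\infty}\Big(\frac{E\sqrt{r_k^{(neg)}}}{n}-\frac{\sqrt{E r_k^{(neg)}}}{n}\Big)=0$. Then $$\lim_{n\to\infty}\frac{E r_n^{(neg)}}{n^2}=\lim_{n\to\infty}\frac{\phi_n}{n^2},$$ where $\phi_1=m$ and $\phi_k=\phi_{k-1}-2\sqrt{\frac{2}{\pi}}\sqrt{\phi_{k-1}}+m$ for $2\le k\le n$.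
   Context: $H_{:,1:k}$ denotes the submatrix of the first $k$ columns of $H$, $H_{:,k}$ its $k$-th column, and $\hat{\mathbf{x}}_{1:k}$ the vector of the first $k$ components of $\hat{\mathbf{x}}$. Ties in the argmin (a probability-zero event) are broken arbitrarily. The limit $n\to\infty$ is taken along $n$ for which $m=\alpha n$ is a positive integer, with $\alpha$ fixed; for each such $n$ the sequence $\phi_1,\dots,\phi_n$ is computed with the corresponding $m$. This is the greedy iterative algorithm for approximately minimizing $\|H\mathbf{x}\|_2^2$ over $\mathbf{x}\in\{-1,1\}^n$. *)

theory Defs
  imports "HOL-Probability.Probability"
begin

text \<open>Matrices and vectors are functions on natural numbers with indices starting at 1; only the
  entries within the stated dimensions matter. The first function is
  \<open>\<parallel>A\<^sub>:\<^sub>,\<^sub>1\<^sub>:\<^sub>k x\<^sub>1\<^sub>:\<^sub>k\<parallel>\<^sup>2\<close> for a matrix with \<open>m\<close> rows.\<close>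

definition sq_norm_cols :: "nat \<Rightarrow> (nat \<Rightarrow> nat \<Rightarrow> real) \<Rightarrow> nat \<Rightarrow> (nat \<Rightarrow> real) \<Rightarrow> real" where
  "sq_norm_cols m A k x = (L2_set (\<lambda>i. \<Sum>j=1..k. A i j * x j) {1..m})\<^sup>2"

text \<open>Membership in the set of minimisers leaves the choice in a tie unconstrained.\<close>

definition greedy_signs :: "nat \<Rightarrow> nat \<Rightarrow> (nat \<Rightarrow> nat \<Rightarrow> real) \<Rightarrow> (nat \<Rightarrow> real) \<Rightarrow> bool" where
  "greedy_signs m n A x \<longleftrightarrow>
     x 1 = 1 \<and>
     (\<forall>k\<in>{2..n}. is_arg_min (\<lambda>s. sq_norm_cols m A k (x(k := s))) (\<lambda>s. s \<in> {-1, 1}) (x k))"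

locale std_gaussian_matrix = prob_space M
  for M :: "'w measure" +
  fixes m n :: nat and H :: "'w \<Rightarrow> nat \<Rightarrow> nat \<Rightarrow> real"
  assumes entries_indep: "indep_vars (\<lambda>_. borel) (\<lambda>(i, j) \<omega>. H \<omega> i j) ({1..m} \<times> {1..n})"
    and entries_std_normal:
      "\<And>i j. i \<in> {1..m} \<Longrightarrow> j \<in> {1..n} \<Longrightarrow>
         distributed M lborel (\<lambda>\<omega>. H \<omega> i j) std_normal_density"

text \<open>Measurability of the signs excludes only non-measurable choices on the null set of ties,
  for which the expectations of the residuals would be meaningless.\<close>

locale greedy_run = std_gaussian_matrix M m n H
  for M :: "'w measure" and m n :: nat and H :: "'w \<Rightarrow> nat \<Rightarrow> nat \<Rightarrow> real" +
  fixes x :: "'w \<Rightarrow> nat \<Rightarrow> real"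
  assumes signs_measurable: "\<And>k. k \<in> {1..n} \<Longrightarrow> random_variable borel (\<lambda>\<omega>. x \<omega> k)"
    and signs_greedy: "\<And>\<omega>. \<omega> \<in> space M \<Longrightarrow> greedy_signs m n (H \<omega>) (x \<omega>)"

definition admissible_sizes :: "real \<Rightarrow> nat set" where
  "admissible_sizes \<alpha> = {n. \<exists>m::nat. 0 < m \<and> real m = \<alpha> * real n}"

definition admissible_at_top :: "real \<Rightarrow> nat filter" where
  "admissible_at_top \<alpha> = inf sequentially (principal (admissible_sizes \<alpha>))"

text \<open>The sequence starts at index 1; the value at index 0 is a dummy.\<close>

fun phi :: "real \<Rightarrow> nat \<Rightarrow> real" where
  "phi m 0 = 0"
| "phi m (Suc 0) = m"
| "phi m (Suc (Suc k)) = phi m (Suc k) - 2 * sqrt (2 / pi) * sqrt (phi m (Suc k)) + m"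

end

theory Submission
  imports Defs
begin

text \<open>Write \<open>v\<close> for the partial sum of the first \<open>k\<close> signed columns and \<open>w\<close> for column \<open>k + 1\<close>. The
  greedy sign makes the cross term as negative as possible, so
  \<open>r\<^sub>k\<^sub>+\<^sub>1 = r\<^sub>k + \<parallel>w\<parallel>\<^sup>2 - 2 \<bar>\<langle>v, w\<rangle>\<bar>\<close> (lemma \<open>greedy_norm_Suc\<close>). As \<open>w\<close> is a standard Gaussian vector
  independent of \<open>v\<close>, the inner product is, given \<open>v\<close>, normal with standard deviation
  \<open>\<parallel>v\<parallel> = sqrt r\<^sub>k\<close>, and \<open>E \<bar>\<langle>v, w\<rangle>\<bar> = sqrt (2 / pi) E (sqrt r\<^sub>k)\<close>; this is the recursion for the means
  (lemma \<open>expectation_r_Suc\<close>). The one delicate point is the independence: a sign chosen in a tie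
  may depend on later columns. The residual is therefore compared with \<open>greedy_residual\<close>, which
  breaks ties by a fixed rule and so is a function of the columns read so far; by independence,
  ties have probability zero and the two agree almost surely.

  For the limit, divide by \<open>n\<^sup>2\<close>. Then \<open>E r\<^sub>k\<close> and \<open>\<phi>\<^sub>k\<close> are both Euler schemes of step \<open>1 / n\<close> for
  \<open>y' = \<alpha> - 2 sqrt (2 / pi) sqrt y\<close>, \<open>y 0 = 0\<close>, the former with an additional error governed by
  \<open>E (sqrt r\<^sub>k) - sqrt (E r\<^sub>k)\<close>. The drift is decreasing in \<open>y\<close>, so a step does not enlarge the distance
  of two solutions except by \<open>O (n\<^sup>-\<^sup>2)\<close>, although the square root is not Lipschitz at the initial
  value (lemma \<open>sqrt_recursion_stable\<close>). Hence the distance after \<open>n\<close> steps is at most the sum of the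
  errors plus \<open>O (1 / n)\<close>. That sum is the integral over \<open>(0, 1]\<close> of a bounded step function, which
  converges to zero pointwise by the concentration hypothesis, and so tends to zero by dominated
  convergence (lemma \<open>mean_tendsto_0\<close>). The same stability estimate, applied to samples of the
  exact solution, shows that \<open>\<phi>\<^sub>n / n\<^sup>2\<close> converges to \<open>y 1\<close> (lemma \<open>phi_scaling_limit\<close>).\<close>

section \<open>Stability of the square root recursion\<close>

text \<open>With \<open>s = sqrt a\<close> and \<open>t = sqrt b\<close> the difference is \<open>(s - t) (s + t - h)\<close>. Either \<open>s + t \<ge> h\<close>, and
  the step contracts, or both roots are below \<open>h\<close> and the product is at most \<open>h\<^sup>2\<close>.\<close>
lemma sqrt_step_nonexpansive:
  fixes a b h :: real
  assumes "a \<ge> 0" "b \<ge> 0" "h \<ge> 0"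
  shows "\<bar>(a - h * sqrt a) - (b - h * sqrt b)\<bar> \<le> \<bar>a - b\<bar> + h\<^sup>2"
proof -
  have aux: "\<bar>(s\<^sup>2 - h * s) - (t\<^sup>2 - h * t)\<bar> \<le> \<bar>s\<^sup>2 - t\<^sup>2\<bar> + h\<^sup>2"
    if "0 \<le> t" "t \<le> s" for s t :: real
  proof -
    have fact: "(s\<^sup>2 - h * s) - (t\<^sup>2 - h * t) = (s - t) * (s + t - h)"
      and sq: "s\<^sup>2 - t\<^sup>2 = (s - t) * (s + t)"
      by (simp_all add: power2_eq_square algebra_simps)
    show ?thesis
    proof (cases "s + t \<ge> h")
      case True
      have "(s - t) * (s + t - h) \<le> (s - t) * (s + t)"
        using that assms by (intro mult_left_mono) auto
      moreover have "0 \<le> (s - t) * (s + t - h)" using that True by simp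
      moreover have "0 \<le> h\<^sup>2" by simp
      ultimately show ?thesis unfolding fact sq by linarith
    next
      case False
      have "(s - t) * (h - (s + t)) \<le> h * h"
        using that False assms by (intro mult_mono) auto
      moreover have "0 \<le> (s - t) * (h - (s + t))" using that False by simp
      moreover have "(s - t) * (s + t - h) = - ((s - t) * (h - (s + t)))"
        by (simp add: algebra_simps)
      ultimately show ?thesis unfolding fact sq by (simp add: power2_eq_square)
    qed
  qed
  show ?thesis
  proof (cases "b \<le> a")
    case True
    then show ?thesis using aux[of "sqrt b" "sqrt a"] assms by simp
  next
    case False
    then show ?thesis using aux[of "sqrt a" "sqrt b"] assms
      by (simp add: abs_minus_commute)
  qed
qed

lemma sqrt_recursion_stable:
  fixes a b e :: "nat \<Rightarrow> real" and g h :: real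
  assumes "h \<ge> 0" "\<And>k. k \<le> n \<Longrightarrow> a k \<ge> 0" "\<And>k. k \<le> n \<Longrightarrow> b k \<ge> 0" "a 0 = b 0"
    and a: "\<And>k. k < n \<Longrightarrow> \<bar>a (Suc k) - (a k - h * sqrt (a k) + g)\<bar> \<le> e k"
    and b: "\<And>k. k < n \<Longrightarrow> b (Suc k) = b k - h * sqrt (b k) + g"
  shows "\<bar>a n - b n\<bar> \<le> (\<Sum>k<n. e k) + real n * h\<^sup>2"
proof -
  have "\<bar>a k - b k\<bar> \<le> (\<Sum>j<k. e j) + real k * h\<^sup>2" if "k \<le> n" for k
    using that
  proof (induction k)
    case 0
    then show ?case using \<open>a 0 = b 0\<close> by simp
  next
    case (Suc k)
    have "\<bar>(a k - h * sqrt (a k)) - (b k - h * sqrt (b k))\<bar> \<le> \<bar>a k - b k\<bar> + h\<^sup>2"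
      using assms Suc.prems by (intro sqrt_step_nonexpansive) auto
    then show ?case
      using a[of k] b[of k] Suc by (simp add: algebra_simps)
  qed
  then show ?thesis by simp
qed

text \<open>The function \<open>\<sigma>\<^sup>2\<close> is the solution of \<open>y' = \<alpha> - 2 c sqrt y\<close>, \<open>y 0 = 0\<close>. Separation of variables
  gives the time \<open>\<tau>\<close> at which \<open>sqrt y\<close> has a given value in closed form, and \<open>\<sigma>\<close> is its inverse. The
  mean value theorem bounds the error of one Euler step by an increment of \<open>\<sigma>\<close>, so that the errors
  of successive steps telescope; this replaces a bound on \<open>y''\<close>.\<close>
lemma limit_curve:
  fixes \<alpha> c :: real
  assumes "\<alpha> > 0" "c > 0"
  obtains \<sigma> :: "real \<Rightarrow> real" where
    "\<sigma> 0 = 0" "\<And>t. t \<ge> 0 \<Longrightarrow> \<sigma> t \<ge> 0"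
    "\<And>t h. t \<ge> 0 \<Longrightarrow> h > 0 \<Longrightarrow>
       \<bar>(\<sigma> (t + h))\<^sup>2 - ((\<sigma> t)\<^sup>2 - 2 * c * h * \<sigma> t + \<alpha> * h)\<bar> \<le> 2 * c * h * (\<sigma> (t + h) - \<sigma> t)"
proof -
  define \<tau> where "\<tau> s = - s / c - \<alpha> / (2 * c\<^sup>2) * ln (1 - 2 * c * s / \<alpha>)" for s
  \<comment> \<open>The equilibrium value of \<open>sqrt y\<close>, never reached because \<open>\<tau>\<close> is unbounded near it.\<close>
  define S where "S = \<alpha> / (2 * c)"
  have dom: "1 - 2 * c * s / \<alpha> > 0" "\<alpha> - 2 * c * s > 0" if "s < S" for s
    using that assms by (auto simp: S_def field_simps)
  have deriv: "(\<tau> has_real_derivative 2 * s / (\<alpha> - 2 * c * s)) (at s)" if "s < S" for s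
  proof -
    have "((\<lambda>s. - s / c - K * ln (1 - 2 * c * s / \<alpha>)) has_real_derivative
        (- 1 / c - K * (- (2 * c / \<alpha>) / (1 - 2 * c * s / \<alpha>)))) (at s)" for K
      using dom[OF that] assms by (auto intro!: derivative_eq_intros simp: mult_ac)
    then have "(\<tau> has_real_derivative
        (- 1 / c - \<alpha> / (2 * c\<^sup>2) * (- (2 * c / \<alpha>) / (1 - 2 * c * s / \<alpha>)))) (at s)"
      unfolding \<tau>_def .
    moreover have "1 - 2 * c * s / \<alpha> = (\<alpha> - 2 * c * s) / \<alpha>" using assms by (simp add: field_simps)
    then have "- 1 / c - \<alpha> / (2 * c\<^sup>2) * (- (2 * c / \<alpha>) / (1 - 2 * c * s / \<alpha>)) = - 1 / c + \<alpha> / c / (\<alpha> - 2 * c * s)"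
      using assms by (simp add: power2_eq_square)
    moreover have "\<dots> = 2 * s / (\<alpha> - 2 * c * s)"
      using dom[OF that] assms by (simp add: divide_simps)
    ultimately show ?thesis by simp
  qed
  have cont: "isCont \<tau> s" if "s < S" for s
    using deriv[OF that] by (rule DERIV_isCont)
  have ex: "\<exists>s. 0 \<le> s \<and> s < S \<and> \<tau> s = t" if "t \<ge> 0" for t
  proof -
    \<comment> \<open>The point \<open>b\<close> is chosen so that the logarithm in \<open>\<tau> b\<close> equals \<open>- K\<close>, and \<open>K\<close> so that \<open>\<tau> b \<ge> t\<close>.\<close>
    define K where "K = 1 + 2 * c\<^sup>2 * t / \<alpha>"
    define b where "b = S * (1 - exp (- K))"
    have "K > 0" using assms that by (simp add: K_def add_pos_nonneg)
    have "S > 0" using assms by (simp add: S_def)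
    then have b: "0 \<le> b" "b < S"
      using \<open>K > 0\<close> mult_strict_left_mono[of "1 - exp (- K)" 1 S] by (auto simp: b_def)
    have "1 - 2 * c * b / \<alpha> = exp (- K)"
      using assms by (simp add: b_def S_def field_simps)
    then have "\<tau> b = - b / c + \<alpha> * K / (2 * c\<^sup>2)" by (simp add: \<tau>_def)
    also have "\<alpha> * K / (2 * c\<^sup>2) = t + S / c"
      using assms by (simp add: K_def S_def field_simps power2_eq_square)
    also have "- b / c + (t + S / c) = t + (S - b) / c" by (simp add: diff_divide_distrib)
    finally have "t \<le> \<tau> b" using b assms by simp
    moreover have "\<tau> 0 \<le> t" using that by (simp add: \<tau>_def)
    moreover have "continuous_on {0..b} \<tau>"
      using b by (intro continuous_at_imp_continuous_on ballI cont) auto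
    ultimately show ?thesis using IVT'[of \<tau> 0 t b] b by force
  qed
  have "\<forall>t. \<exists>s. t \<ge> 0 \<longrightarrow> 0 \<le> s \<and> s < S \<and> \<tau> s = t \<and> (t = 0 \<longrightarrow> s = 0)"
  proof
    fix t :: real
    have "\<tau> 0 = 0" "0 < S" using assms by (auto simp: \<tau>_def S_def)
    then show "\<exists>s. t \<ge> 0 \<longrightarrow> 0 \<le> s \<and> s < S \<and> \<tau> s = t \<and> (t = 0 \<longrightarrow> s = 0)"
      using ex[of t] by (cases "t = 0") auto
  qed
  then obtain \<sigma> where \<sigma>: "\<And>t. t \<ge> 0 \<Longrightarrow> 0 \<le> \<sigma> t \<and> \<sigma> t < S \<and> \<tau> (\<sigma> t) = t \<and> (t = 0 \<longrightarrow> \<sigma> t = 0)"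
    by metis
  have step: "\<bar>(\<sigma> (t + h))\<^sup>2 - ((\<sigma> t)\<^sup>2 - 2 * c * h * \<sigma> t + \<alpha> * h)\<bar> \<le> 2 * c * h * (\<sigma> (t + h) - \<sigma> t)"
    if "t \<ge> 0" "h > 0" for t h
  proof -
    let ?a = "\<sigma> t" and ?b = "\<sigma> (t + h)"
    have a: "0 \<le> ?a" "?a < S" "\<tau> ?a = t" and b: "0 \<le> ?b" "?b < S" "\<tau> ?b = t + h"
      using \<sigma>[of t] \<sigma>[of "t + h"] that by auto
    have "?a < ?b"
    proof (rule ccontr)
      assume "\<not> ?a < ?b"
      then have "\<tau> ?b \<le> \<tau> ?a"
        using a b dom by (intro DERIV_nonneg_imp_nondecreasing[of ?b ?a \<tau>]) (force intro!: deriv divide_nonneg_pos)+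
      then show False using a b that by simp
    qed
    then have "\<exists>\<xi>. ?a < \<xi> \<and> \<xi> < ?b \<and> (?b\<^sup>2 - ?a\<^sup>2) * (2 * \<xi> / (\<alpha> - 2 * c * \<xi>)) = (\<tau> ?b - \<tau> ?a) * (2 * \<xi>)"
      using b by (intro GMVT'[where f = "\<lambda>s. s\<^sup>2"]) (auto intro!: cont deriv derivative_eq_intros)
    then obtain \<xi> where \<xi>: "?a < \<xi>" "\<xi> < ?b"
      "(?b\<^sup>2 - ?a\<^sup>2) * (2 * \<xi> / (\<alpha> - 2 * c * \<xi>)) = (\<tau> ?b - \<tau> ?a) * (2 * \<xi>)"
      by blast
    have "\<xi> > 0" "\<alpha> - 2 * c * \<xi> > 0" using \<xi> a b dom[of \<xi>] by auto
    have "(2 * \<xi>) * ((?b\<^sup>2 - ?a\<^sup>2) / (\<alpha> - 2 * c * \<xi>)) = (2 * \<xi>) * h"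
      using \<xi>(3) unfolding a(3) b(3) by (simp add: mult.commute)
    then have "(?b\<^sup>2 - ?a\<^sup>2) / (\<alpha> - 2 * c * \<xi>) = h"
      using \<open>\<xi> > 0\<close> by (simp only: mult_cancel_left) simp
    then have "?b\<^sup>2 - ?a\<^sup>2 = h * (\<alpha> - 2 * c * \<xi>)"
      using \<open>\<alpha> - 2 * c * \<xi> > 0\<close> by (simp only: divide_eq_eq)
    then have eq: "?b\<^sup>2 - (?a\<^sup>2 - 2 * c * h * ?a + \<alpha> * h) = - (2 * c * h * (\<xi> - ?a))"
      by (simp add: algebra_simps)
    have "0 \<le> 2 * c * h * (\<xi> - ?a)" "2 * c * h * (\<xi> - ?a) \<le> 2 * c * h * (?b - ?a)"
      using \<xi> that assms by (auto intro!: mult_left_mono)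
    then show ?thesis unfolding eq by simp
  qed
  show thesis
    by (rule that[of \<sigma>]) (use \<sigma> step in auto)
qed

section \<open>The deterministic sequence\<close>

text \<open>The value 0 at index 0 is consistent with the recursion, which therefore may start there.\<close>
lemma phi_Suc: "phi \<mu> (Suc k) = phi \<mu> k - 2 * sqrt (2 / pi) * sqrt (phi \<mu> k) + \<mu>"
  by (cases k) auto

text \<open>The next value is \<open>(sqrt \<phi> - c)\<^sup>2 + (\<mu> - c\<^sup>2)\<close> with \<open>c\<^sup>2 = 2 / pi < 1\<close>, hence the lower bound on \<open>\<mu>\<close>.\<close>
lemma phi_nonneg:
  assumes "\<mu> \<ge> 1"
  shows "phi \<mu> k \<ge> 0"
proof (induction k)
  case (Suc k)
  let ?s = "sqrt (phi \<mu> k)" and ?c = "sqrt (2 / pi)"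
  have "?c\<^sup>2 \<le> 1" using pi_ge_two by simp
  moreover have "phi \<mu> (Suc k) = (?s - ?c)\<^sup>2 + (\<mu> - ?c\<^sup>2)"
    using Suc unfolding phi_Suc power2_diff real_sqrt_pow2[OF Suc] by (simp only: mult_ac)
  moreover have "(?s - ?c)\<^sup>2 \<ge> 0" by (rule zero_le_power2)
  ultimately show ?case using assms by linarith
qed simp

lemma scaled_phi_Suc:
  assumes "n > 0" "\<mu> = \<alpha> * real n"
  shows "phi \<mu> (Suc k) / (real n)\<^sup>2 =
    phi \<mu> k / (real n)\<^sup>2 - 2 * sqrt (2 / pi) / real n * sqrt (phi \<mu> k / (real n)\<^sup>2) + \<alpha> / real n"
proof -
  have "sqrt (phi \<mu> k / (real n)\<^sup>2) = sqrt (phi \<mu> k) / real n"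
    by (simp add: real_sqrt_divide)
  then show ?thesis
    using assms unfolding phi_Suc
    by (simp add: add_divide_distrib diff_divide_distrib power2_eq_square)
qed

lemma phi_scaling_limit:
  fixes \<alpha> :: real
  assumes "\<alpha> > 0"
  obtains L D where
    "\<And>n \<mu>. n > 0 \<Longrightarrow> \<mu> = \<alpha> * real n \<Longrightarrow> \<mu> \<ge> 1 \<Longrightarrow> \<bar>phi \<mu> n / (real n)\<^sup>2 - L\<bar> \<le> D / real n"
proof -
  define c where "c = sqrt (2 / pi)"
  have "c > 0" by (simp add: c_def)
  obtain \<sigma> where \<sigma>: "\<sigma> 0 = 0" "\<And>t. t \<ge> 0 \<Longrightarrow> \<sigma> t \<ge> 0"
    "\<And>t h. t \<ge> 0 \<Longrightarrow> h > 0 \<Longrightarrow>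
       \<bar>(\<sigma> (t + h))\<^sup>2 - ((\<sigma> t)\<^sup>2 - 2 * c * h * \<sigma> t + \<alpha> * h)\<bar> \<le> 2 * c * h * (\<sigma> (t + h) - \<sigma> t)"
    using limit_curve[OF assms \<open>c > 0\<close>] by blast
  show thesis
  proof (rule that[of "(\<sigma> 1)\<^sup>2" "2 * c * \<sigma> 1 + 4 * c\<^sup>2"])
    fix n :: nat and \<mu> :: real
    assume n: "n > 0" and \<mu>: "\<mu> = \<alpha> * real n" "\<mu> \<ge> 1"
    let ?h = "2 * c / real n"
    have "\<bar>(\<sigma> (real n / real n))\<^sup>2 - phi \<mu> n / (real n)\<^sup>2\<bar>
      \<le> (\<Sum>k<n. ?h * (\<sigma> (real (Suc k) / real n) - \<sigma> (real k / real n))) + real n * ?h\<^sup>2"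
    proof (rule sqrt_recursion_stable[where a = "\<lambda>k. (\<sigma> (real k / real n))\<^sup>2"
          and b = "\<lambda>k. phi \<mu> k / (real n)\<^sup>2" and g = "\<alpha> / real n"])
      fix k
      have "real (Suc k) / real n = real k / real n + 1 / real n" by (simp add: add_divide_distrib)
      then show "\<bar>(\<sigma> (real (Suc k) / real n))\<^sup>2
          - ((\<sigma> (real k / real n))\<^sup>2 - ?h * sqrt ((\<sigma> (real k / real n))\<^sup>2) + \<alpha> / real n)\<bar>
          \<le> ?h * (\<sigma> (real (Suc k) / real n) - \<sigma> (real k / real n))"
        using \<sigma>(3)[of "real k / real n" "1 / real n"] \<sigma>(2)[of "real k / real n"] n by simp
      show "phi \<mu> (Suc k) / (real n)\<^sup>2
          = phi \<mu> k / (real n)\<^sup>2 - ?h * sqrt (phi \<mu> k / (real n)\<^sup>2) + \<alpha> / real n"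
        unfolding c_def by (rule scaled_phi_Suc[OF n \<mu>(1)])
    qed (use \<sigma>(1) \<open>c > 0\<close> phi_nonneg[OF \<mu>(2)] in auto)
    also have "(\<Sum>k<n. ?h * (\<sigma> (real (Suc k) / real n) - \<sigma> (real k / real n)))
        = ?h * (\<Sum>k<n. \<sigma> (real (Suc k) / real n) - \<sigma> (real k / real n))"
      by (rule sum_distrib_left[symmetric])
    also have "(\<Sum>k<n. \<sigma> (real (Suc k) / real n) - \<sigma> (real k / real n)) = \<sigma> 1"
      using sum_lessThan_telescope[of "\<lambda>k. \<sigma> (real k / real n)" n] \<sigma>(1) n by simp
    also have "?h * \<sigma> 1 + real n * ?h\<^sup>2 = (2 * c * \<sigma> 1 + 4 * c\<^sup>2) / real n"
      using n by (simp add: field_simps power2_eq_square)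
    finally show "\<bar>phi \<mu> n / (real n)\<^sup>2 - (\<sigma> 1)\<^sup>2\<bar> \<le> (2 * c * \<sigma> 1 + 4 * c\<^sup>2) / real n"
      using n by (simp add: abs_minus_commute)
  qed
qed

section \<open>From pointwise to averaged concentration\<close>

text \<open>Since \<open>\<lceil>c n\<rceil> = k\<close> exactly for \<open>c \<in> ((k - 1) / n, k / n]\<close>, the mean is the integral over \<open>(0, 1]\<close> of
  \<open>\<bar>f n \<lceil>c n\<rceil>\<bar>\<close>, and dominated convergence applies.\<close>
lemma mean_tendsto_0:
  fixes f :: "nat \<Rightarrow> nat \<Rightarrow> real"
  assumes bound: "\<And>n k. k \<le> n \<Longrightarrow> \<bar>f n k\<bar> \<le> B"
    and lim: "\<And>c. 0 < c \<Longrightarrow> c \<le> 1 \<Longrightarrow> (\<lambda>n. f n (nat \<lceil>c * real n\<rceil>)) \<longlonglongrightarrow> 0"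
  shows "(\<lambda>n. (\<Sum>k=1..n. \<bar>f n k\<bar>) / real n) \<longlonglongrightarrow> 0"
proof -
  define s where "s n c = indicator {0<..1} c * \<bar>f n (nat \<lceil>c * real n\<rceil>)\<bar>" for n and c :: real
  have le: "nat \<lceil>c * real n\<rceil> \<le> n" if "c \<le> 1" for c n
    using that mult_right_mono[of c 1 "real n"] by (simp add: nat_le_iff ceiling_le_iff)
  have "(\<lambda>n. \<integral>c. s n c \<partial>lborel) \<longlonglongrightarrow> (\<integral>c. 0 \<partial>(lborel :: real measure))"
  proof (rule integral_dominated_convergence[where w = "\<lambda>c. indicator {0<..1} c * B"])
    show "s n \<in> borel_measurable lborel" for n
      unfolding s_def by measurable
    show "integrable lborel (\<lambda>c. indicator {0<..1::real} c * B)"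
      by (intro integrable_mult_left integrable_real_indicator) auto
    show "AE c in lborel. (\<lambda>n. s n c) \<longlonglongrightarrow> 0"
      unfolding s_def using lim by (intro AE_I2) (auto simp: indicator_def tendsto_rabs_zero)
    show "AE c in lborel. norm (s n c) \<le> indicator {0<..1} c * B" for n
      unfolding s_def using bound le by (intro AE_I2) (auto simp: indicator_def)
  qed simp
  moreover have "(\<integral>c. s n c \<partial>lborel) = (\<Sum>k=1..n. \<bar>f n k\<bar>) / real n" if "n > 0" for n
  proof -
    note n0 = gr_implies_not0[OF that]
    have "s n c = (\<Sum>k=1..n. \<bar>f n k\<bar> * indicator {(real k - 1) / n<..real k / n} c)" for c
    proof -
      have mem: "c \<in> {(real k - 1) / n<..real k / n} \<longleftrightarrow> \<lceil>c * real n\<rceil> = int k" for k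
        using n0 by (simp add: ceiling_eq_iff field_simps)
      show ?thesis
      proof (cases "c \<in> {0<..1}")
        case True
        let ?k = "nat \<lceil>c * real n\<rceil>"
        have "0 < c * real n" using True n0 by simp
        then have k: "?k \<in> {1..n}" "\<lceil>c * real n\<rceil> = int ?k"
          using le[of c n] True by (auto simp: le_nat_iff)
        have "(\<Sum>k=1..n. \<bar>f n k\<bar> * indicator {(real k - 1) / n<..real k / n} c)
            = (\<Sum>k=1..n. if k = ?k then \<bar>f n k\<bar> else 0)"
          unfolding indicator_def mem using k by (intro sum.cong) auto
        then show ?thesis using k True by (simp add: s_def)
      next
        case outside: False
        have "c \<notin> {(real k - 1) / n<..real k / n}" if "k \<in> {1..n}" for k
        proof
          assume c: "c \<in> {(real k - 1) / n<..real k / n}"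
          have "0 \<le> (real k - 1) / n" "real k / n \<le> 1" using that by auto
          then show False using c outside by auto
        qed
        then show ?thesis using outside by (simp add: s_def)
      qed
    qed
    then have "(\<integral>c. s n c \<partial>lborel)
        = (\<integral>c. (\<Sum>k=1..n. \<bar>f n k\<bar> * indicator {(real k - 1) / n<..real k / n} c) \<partial>lborel)"
      by (simp only:)
    also have "\<dots> = (\<Sum>k=1..n. \<integral>c. \<bar>f n k\<bar> * indicator {(real k - 1) / n<..real k / n} c \<partial>lborel)"
      by (intro Bochner_Integration.integral_sum integrable_mult_right integrable_real_indicator)
         (auto simp: divide_right_mono)
    also have "\<dots> = (\<Sum>k=1..n. \<bar>f n k\<bar> / real n)"
    proof (rule sum.cong)
      fix k
      have "real k / real n - (real k - 1) / real n = 1 / real n"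
        by (simp add: diff_divide_distrib)
      moreover have "(real k - 1) / real n \<le> real k / real n"
        by (simp add: divide_right_mono)
      ultimately show "(\<integral>c. \<bar>f n k\<bar> * indicator {(real k - 1) / n<..real k / n} c \<partial>lborel) = \<bar>f n k\<bar> / real n"
        by (simp del: divide_le_cancel)
    qed simp
    finally show ?thesis by (simp add: sum_divide_distrib)
  qed
  then have "\<forall>\<^sub>F n in sequentially. (\<integral>c. s n c \<partial>lborel) = (\<Sum>k=1..n. \<bar>f n k\<bar>) / real n"
    using eventually_gt_at_top[of 0] by (rule eventually_mono[rotated])
  ultimately show ?thesis by (simp add: tendsto_cong)
qed

section \<open>The greedy step\<close>

text \<open>Ties are resolved in favour of the sign 1, which also produces the prescribed first sign, because
  the inner product with the initial zero residual is 0.\<close>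
fun greedy_residual :: "nat \<Rightarrow> (nat \<Rightarrow> nat \<Rightarrow> real) \<Rightarrow> nat \<Rightarrow> nat \<Rightarrow> real" where
  "greedy_residual m A 0 i = 0"
| "greedy_residual m A (Suc k) i = greedy_residual m A k i
     + (if (\<Sum>l=1..m. greedy_residual m A k l * A l (Suc k)) > 0 then -1 else 1) * A i (Suc k)"

lemma sq_norm_cols_eq_sum: "sq_norm_cols m A k x = (\<Sum>i=1..m. (\<Sum>j=1..k. A i j * x j)\<^sup>2)"
  by (simp add: sq_norm_cols_def L2_set_def sum_nonneg)

lemma sq_norm_cols_Suc_update:
  assumes "s \<in> {-1, 1}"
  shows "sq_norm_cols m A (Suc k) (x(Suc k := s)) = sq_norm_cols m A k x + (\<Sum>i=1..m. (A i (Suc k))\<^sup>2)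
     + 2 * s * (\<Sum>i=1..m. (\<Sum>j=1..k. A i j * x j) * A i (Suc k))"
proof -
  have "(\<Sum>j=1..Suc k. A i j * (x(Suc k := s)) j) = (\<Sum>j=1..k. A i j * x j) + A i (Suc k) * s" for i
  proof -
    have "(\<Sum>j=1..k. A i j * (x(Suc k := s)) j) = (\<Sum>j=1..k. A i j * x j)"
      by (rule sum.cong) auto
    then show ?thesis by simp
  qed
  moreover have "s\<^sup>2 = 1" using assms by auto
  ultimately show ?thesis
    unfolding sq_norm_cols_eq_sum
    by (simp add: power2_sum power_mult_distrib sum.distrib sum_distrib_left mult_ac)
qed

lemma greedy_step:
  assumes "greedy_signs m n A x" "k \<in> {1..<n}"
  shows "sq_norm_cols m A (Suc k) x = sq_norm_cols m A k x + (\<Sum>i=1..m. (A i (Suc k))\<^sup>2)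
     - 2 * \<bar>\<Sum>i=1..m. (\<Sum>j=1..k. A i j * x j) * A i (Suc k)\<bar>" (is ?norm)
    and "(\<Sum>i=1..m. (\<Sum>j=1..k. A i j * x j) * A i (Suc k)) \<noteq> 0 \<Longrightarrow>
      x (Suc k) = (if (\<Sum>i=1..m. (\<Sum>j=1..k. A i j * x j) * A i (Suc k)) > 0 then -1 else 1)" (is "_ \<Longrightarrow> ?sign")
proof -
  let ?w = "(\<Sum>i=1..m. (\<Sum>j=1..k. A i j * x j) * A i (Suc k))"
  let ?f = "\<lambda>s. sq_norm_cols m A (Suc k) (x(Suc k := s))"
  have "is_arg_min ?f (\<lambda>s. s \<in> {-1, 1}) (x (Suc k))"
    using assms by (auto simp: greedy_signs_def)
  then have s: "x (Suc k) \<in> {-1, 1}" and "\<not> ?f (- x (Suc k)) < ?f (x (Suc k))"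
    by (auto simp: is_arg_min_def)
  then have le: "x (Suc k) * ?w \<le> - (x (Suc k) * ?w)"
    using sq_norm_cols_Suc_update[of "x (Suc k)" m A k x] sq_norm_cols_Suc_update[of "- x (Suc k)" m A k x]
    by auto
  then have "x (Suc k) * ?w = - \<bar>?w\<bar>"
    using s by (auto simp: abs_if)
  then show ?norm
    using sq_norm_cols_Suc_update[OF s, of m A k x] by (simp add: algebra_simps)
  show ?sign if "?w \<noteq> 0"
    using s le that by (auto split: if_splits)
qed

text \<open>For \<open>k = 0\<close> the previous partial sum vanishes and the first sign is prescribed, so the formula
  also covers the start of the algorithm.\<close>
lemma greedy_norm_Suc:
  assumes "greedy_signs m n A x" "k < n"
  shows "sq_norm_cols m A (Suc k) x = sq_norm_cols m A k x + (\<Sum>i=1..m. (A i (Suc k))\<^sup>2)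
     - 2 * \<bar>\<Sum>i=1..m. (\<Sum>j=1..k. A i j * x j) * A i (Suc k)\<bar>"
proof (cases "k = 0")
  case True
  then show ?thesis using assms by (simp add: sq_norm_cols_eq_sum greedy_signs_def)
next
  case False
  then show ?thesis using assms by (intro greedy_step(1)) auto
qed

lemma greedy_residual_eq:
  assumes "greedy_signs m n A x"
    and no_tie: "\<And>k. k \<in> {1..<n} \<Longrightarrow> (\<Sum>i=1..m. greedy_residual m A k i * A i (Suc k)) \<noteq> 0"
    and "k \<le> n"
  shows "(\<Sum>j=1..k. A i j * x j) = greedy_residual m A k i"
  using \<open>k \<le> n\<close>
proof (induction k arbitrary: i)
  case (Suc k)
  have IH: "(\<Sum>j=1..k. A i j * x j) = greedy_residual m A k i" for i
    using Suc by simp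
  show ?case
  proof (cases "k = 0")
    case True
    then show ?thesis using assms(1) by (simp add: greedy_signs_def)
  next
    case False
    then have "x (Suc k) = (if (\<Sum>l=1..m. greedy_residual m A k l * A l (Suc k)) > 0 then -1 else 1)"
      using greedy_step(2)[OF assms(1), of k] no_tie[of k] Suc.prems unfolding IH by auto
    then show ?thesis using IH[of i] by simp
  qed
qed simp

lemma greedy_residual_cong:
  assumes "\<And>i j. i \<in> {1..m} \<Longrightarrow> j \<in> {1..k} \<Longrightarrow> A i j = B i j" "i \<in> {1..m}"
  shows "greedy_residual m A k i = greedy_residual m B k i"
  using assms
proof (induction k arbitrary: i)
  case (Suc k)
  have IH: "greedy_residual m A k i = greedy_residual m B k i" if "i \<in> {1..m}" for i
    using Suc that by auto
  have "(\<Sum>l=1..m. greedy_residual m A k l * A l (Suc k)) = (\<Sum>l=1..m. greedy_residual m B k l * B l (Suc k))"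
    using IH Suc.prems by (intro sum.cong) auto
  then show ?case using IH Suc.prems by simp
qed simp

lemma greedy_residual_measurable:
  assumes "{1..m} \<times> {1..k} \<subseteq> J" "i \<in> {1..m}"
  shows "(\<lambda>z. greedy_residual m (curry z) k i) \<in> borel_measurable (PiM J (\<lambda>_. borel))"
  using assms
proof (induction k arbitrary: i)
  case (Suc k)
  have res: "(\<lambda>z. greedy_residual m (curry z) k i) \<in> borel_measurable (PiM J (\<lambda>_. borel))"
    if "i \<in> {1..m}" for i
    using Suc.prems by (intro Suc.IH that) auto
  have comp: "(\<lambda>z. curry z i (Suc k)) \<in> borel_measurable (PiM J (\<lambda>_. borel :: real measure))"
    if "i \<in> {1..m}" for i
    unfolding curry_conv using Suc.prems(1) that by (intro measurable_component_singleton) auto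
  have [measurable]: "(\<lambda>z. \<Sum>l=1..m. greedy_residual m (curry z) k l * curry z l (Suc k))
      \<in> borel_measurable (PiM J (\<lambda>_. borel))"
    by (intro borel_measurable_sum borel_measurable_times res comp)
  note [measurable] = res[OF Suc.prems(2)] comp[OF Suc.prems(2)]
  show ?case
    unfolding greedy_residual.simps by measurable
qed simp

section \<open>Independence and Gaussian columns\<close>

context prob_space
begin

lemma nn_integral_indep_var:
  assumes "indep_var S X T Y" and [measurable]: "h \<in> borel_measurable (S \<Otimes>\<^sub>M T)"
  shows "(\<integral>\<^sup>+\<omega>. h (X \<omega>, Y \<omega>) \<partial>M) = (\<integral>\<^sup>+\<omega>. \<integral>\<^sup>+\<omega>'. h (X \<omega>, Y \<omega>') \<partial>M \<partial>M)"
proof -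
  have X[measurable]: "random_variable S X" and Y[measurable]: "random_variable T Y"
    using assms(1) by (auto dest: indep_var_rv1 indep_var_rv2)
  interpret Y: prob_space "distr M T Y" by (rule prob_space_distr) (rule Y)
  have "(\<integral>\<^sup>+\<omega>. h (X \<omega>, Y \<omega>) \<partial>M) = (\<integral>\<^sup>+p. h p \<partial>distr M (S \<Otimes>\<^sub>M T) (\<lambda>\<omega>. (X \<omega>, Y \<omega>)))"
    by (simp add: nn_integral_distr)
  also have "distr M (S \<Otimes>\<^sub>M T) (\<lambda>\<omega>. (X \<omega>, Y \<omega>)) = distr M S X \<Otimes>\<^sub>M distr M T Y"
    using assms(1) by (simp add: indep_var_distribution_eq)
  also have "(\<integral>\<^sup>+p. h p \<partial>\<dots>) = (\<integral>\<^sup>+x. \<integral>\<^sup>+y. h (x, y) \<partial>distr M T Y \<partial>distr M S X)"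
    by (rule Y.nn_integral_fst[symmetric]) simp
  also have "\<dots> = (\<integral>\<^sup>+\<omega>. \<integral>\<^sup>+y. h (X \<omega>, y) \<partial>distr M T Y \<partial>M)"
    by (rule nn_integral_distr) (use Y.borel_measurable_nn_integral in measurable)
  also have "\<dots> = (\<integral>\<^sup>+\<omega>. \<integral>\<^sup>+\<omega>'. h (X \<omega>, Y \<omega>') \<partial>M \<partial>M)"
  proof (rule nn_integral_cong)
    fix \<omega> assume "\<omega> \<in> space M"
    then have [measurable]: "X \<omega> \<in> space S" by (rule measurable_space[OF X])
    show "(\<integral>\<^sup>+y. h (X \<omega>, y) \<partial>distr M T Y) = (\<integral>\<^sup>+\<omega>'. h (X \<omega>, Y \<omega>') \<partial>M)"
      by (rule nn_integral_distr) measurable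
  qed
  finally show ?thesis .
qed

lemma AE_indep_var:
  assumes "indep_var S X T Y" and [measurable]: "Measurable.pred (S \<Otimes>\<^sub>M T) P"
    and AE: "AE \<omega> in M. AE \<omega>' in M. P (X \<omega>, Y \<omega>')"
  shows "AE \<omega> in M. P (X \<omega>, Y \<omega>)"
proof -
  have [measurable]: "random_variable S X" "random_variable T Y"
    using assms(1) by (auto dest: indep_var_rv1 indep_var_rv2)
  define h :: "_ \<Rightarrow> ennreal" where "h p = (if P p then 0 else 1)" for p
  have [measurable]: "h \<in> borel_measurable (S \<Otimes>\<^sub>M T)"
    unfolding h_def by measurable
  have "(\<integral>\<^sup>+\<omega>. h (X \<omega>, Y \<omega>) \<partial>M) = (\<integral>\<^sup>+\<omega>. \<integral>\<^sup>+\<omega>'. h (X \<omega>, Y \<omega>') \<partial>M \<partial>M)"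
    by (rule nn_integral_indep_var[OF assms(1)]) simp
  also have "\<dots> = (\<integral>\<^sup>+\<omega>. 0 \<partial>M)"
  proof (rule nn_integral_cong_AE)
    show "AE \<omega> in M. (\<integral>\<^sup>+\<omega>'. h (X \<omega>, Y \<omega>') \<partial>M) = 0"
      using AE
    proof eventually_elim
      case (elim \<omega>)
      then have "(\<integral>\<^sup>+\<omega>'. h (X \<omega>, Y \<omega>') \<partial>M) = (\<integral>\<^sup>+\<omega>'. 0 \<partial>M)"
        by (intro nn_integral_cong_AE) (auto simp: h_def)
      then show ?case by simp
    qed
  qed
  finally have "AE \<omega> in M. h (X \<omega>, Y \<omega>) = 0"
    by (simp add: nn_integral_0_iff_AE)
  then show ?thesis
    by eventually_elim (simp add: h_def split: if_splits)
qed

lemma distributed_lborel_AE_neq: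
  fixes X :: "'a \<Rightarrow> real"
  assumes "distributed M lborel X f"
  shows "AE \<omega> in M. X \<omega> \<noteq> c"
proof -
  have "AE t in lborel. t \<noteq> c" by (rule AE_lborel_singleton)
  then have "AE t in lborel. 0 < f t \<longrightarrow> t \<noteq> c" by eventually_elim simp
  then show ?thesis
    by (subst distributed_AE2[OF assms]) auto
qed

lemma nn_integral_abs_normal:
  assumes "distributed M lborel X (normal_density 0 \<sigma>)" "\<sigma> > 0"
  shows "(\<integral>\<^sup>+\<omega>. ennreal \<bar>X \<omega>\<bar> \<partial>M) = ennreal (sqrt (2 / pi) * \<sigma>)"
proof -
  have "(\<integral>\<^sup>+\<omega>. ennreal \<bar>X \<omega>\<bar> \<partial>M) = (\<integral>\<^sup>+t. ennreal (normal_density 0 \<sigma> t) * ennreal \<bar>t\<bar> \<partial>lborel)"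
    using distributed_nn_integral[OF assms(1), of "\<lambda>t. ennreal \<bar>t\<bar>"] by simp
  also have "\<dots> = (\<integral>\<^sup>+t. ennreal (normal_density 0 \<sigma> t * \<bar>t\<bar>) \<partial>lborel)"
    by (simp add: ennreal_mult)
  also have "\<dots> = ennreal (sqrt (2 / pi) * \<sigma>)"
    using normal_moment_abs_odd[OF assms(2), of 0 0] assms(2)
    by (subst nn_integral_eq_integral) (auto simp: has_bochner_integral_iff mult_ac)
  finally show ?thesis .
qed

end

context std_gaussian_matrix
begin

lemma entry_measurable:
  assumes "i \<in> {1..m}" "j \<in> {1..n}"
  shows "(\<lambda>\<omega>. H \<omega> i j) \<in> borel_measurable M"
  using distributed_measurable[OF entries_std_normal[OF assms]] by simp

lemma entries_indep': "indep_vars (\<lambda>_. borel) (\<lambda>p \<omega>. H \<omega> (fst p) (snd p)) ({1..m} \<times> {1..n})"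
  using entries_indep by (simp add: case_prod_beta')

lemma column_combination_normal:
  assumes "j \<in> {1..n}" "\<exists>i\<in>{1..m}. u i \<noteq> 0"
  shows "distributed M lborel (\<lambda>\<omega>. \<Sum>i=1..m. u i * H \<omega> i j) (normal_density 0 (L2_set u {1..m}))"
proof -
  \<comment> \<open>Zero coefficients contribute degenerate summands without a density and are dropped first.\<close>
  define I where "I = {i\<in>{1..m}. u i \<noteq> 0}"
  have I: "finite I" "I \<noteq> {}" "I \<subseteq> {1..m}" using assms(2) by (auto simp: I_def)
  have "indep_vars (\<lambda>_. borel) (\<lambda>p \<omega>. u (fst p) * H \<omega> (fst p) (snd p)) (I \<times> {j})"
    using I assms(1)
    by (intro indep_vars_compose2[where Y = "\<lambda>p h. u (fst p) * h", OF indep_vars_subset[OF entries_indep']]) auto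
  then have "distributed M lborel (\<lambda>\<omega>. \<Sum>p\<in>I \<times> {j}. u (fst p) * H \<omega> (fst p) (snd p))
      (normal_density (\<Sum>p\<in>I \<times> {j}. 0) (sqrt (\<Sum>p\<in>I \<times> {j}. \<bar>u (fst p)\<bar>\<^sup>2)))"
  proof (rule sum_indep_normal[rotated 2])
    fix p assume "p \<in> I \<times> {j}"
    then have "p \<in> {1..m} \<times> {1..n}" "u (fst p) \<noteq> 0" using assms(1) by (auto simp: I_def)
    then show "distributed M lborel (\<lambda>\<omega>. u (fst p) * H \<omega> (fst p) (snd p)) (normal_density 0 \<bar>u (fst p)\<bar>)"
      using normal_density_affine[OF entries_std_normal, of "fst p" "snd p" "u (fst p)" 0] by auto
  qed (use I in \<open>auto simp: I_def\<close>)
  moreover have "(\<Sum>p\<in>I \<times> {j}. f p) = (\<Sum>i\<in>I. f (i, j))" for f :: "nat \<times> nat \<Rightarrow> real"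
    using sum.cartesian_product'[of f I "{j}"] by simp
  moreover have "(\<Sum>i\<in>I. u i * H \<omega> i j) = (\<Sum>i=1..m. u i * H \<omega> i j)" for \<omega>
    by (rule sum.mono_neutral_left) (auto simp: I_def)
  moreover have "(\<Sum>i\<in>I. (u i)\<^sup>2) = (\<Sum>i=1..m. (u i)\<^sup>2)"
    by (rule sum.mono_neutral_left) (auto simp: I_def)
  ultimately show ?thesis
    by (simp add: L2_set_def)
qed

lemma nn_integral_abs_column_combination:
  assumes "j \<in> {1..n}"
  shows "(\<integral>\<^sup>+\<omega>. ennreal \<bar>\<Sum>i=1..m. u i * H \<omega> i j\<bar> \<partial>M) = ennreal (sqrt (2 / pi) * L2_set u {1..m})"
proof (cases "\<exists>i\<in>{1..m}. u i \<noteq> 0")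
  case True
  then have "L2_set u {1..m} > 0"
    by (simp add: order_less_le L2_set_nonneg L2_set_eq_0_iff eq_commute[of 0])
  then show ?thesis
    using column_combination_normal[OF assms True] by (rule nn_integral_abs_normal[rotated])
next
  case False
  then show ?thesis by (simp add: L2_set_def)
qed

lemma entry_square:
  assumes "i \<in> {1..m}" "j \<in> {1..n}"
  shows "integrable M (\<lambda>\<omega>. (H \<omega> i j)\<^sup>2)" "(\<integral>\<omega>. (H \<omega> i j)\<^sup>2 \<partial>M) = 1"
proof -
  note D = entries_std_normal[OF assms]
  have mom: "has_bochner_integral lborel (\<lambda>t::real. std_normal_density t * t\<^sup>2) 1"
    using std_normal_moment_even[of 1] by simp
  show "integrable M (\<lambda>\<omega>. (H \<omega> i j)\<^sup>2)"
    using distributed_integrable[OF D, of "\<lambda>t. t\<^sup>2"] mom by (auto simp: integrable.simps)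
  show "(\<integral>\<omega>. (H \<omega> i j)\<^sup>2 \<partial>M) = 1"
    using distributed_integral[OF D, of "\<lambda>t. t\<^sup>2"] has_bochner_integral_integral_eq[OF mom] by simp
qed

definition residual_vector :: "nat \<Rightarrow> 'w \<Rightarrow> nat \<Rightarrow> real" where
  "residual_vector k \<omega> = restrict (greedy_residual m (H \<omega>) k) {1..m}"

definition gaussian_column :: "nat \<Rightarrow> 'w \<Rightarrow> nat \<Rightarrow> real" where
  "gaussian_column j \<omega> = restrict (\<lambda>i. H \<omega> i j) {1..m}"

text \<open>The residual after \<open>k\<close> steps is a function of the first \<open>k\<close> columns, and these are independent
  of column \<open>k + 1\<close>.\<close>
lemma residual_indep_column:
  assumes "k < n"
  shows "indep_var (PiM {1..m} (\<lambda>_. borel)) (residual_vector k) (PiM {1..m} (\<lambda>_. borel)) (gaussian_column (Suc k))"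
proof -
  let ?A = "{1..m} \<times> {1..k}" and ?B = "{1..m} \<times> {Suc k}"
  let ?X = "\<lambda>A \<omega>. restrict (\<lambda>p. H \<omega> (fst p) (snd p)) A"
  let ?f = "\<lambda>z. \<lambda>i\<in>{1..m}. greedy_residual m (curry z) k i" and ?g = "\<lambda>z. \<lambda>i\<in>{1..m}. z (i, Suc k)"
  have "indep_var (PiM ?A (\<lambda>_. borel)) (?X ?A) (PiM ?B (\<lambda>_. borel)) (?X ?B)"
    using assms by (intro indep_var_restrict[OF entries_indep']) auto
  moreover have "?f \<in> PiM ?A (\<lambda>_. borel) \<rightarrow>\<^sub>M PiM {1..m} (\<lambda>_. borel)"
    by (intro measurable_restrict greedy_residual_measurable) auto
  moreover have "?g \<in> PiM ?B (\<lambda>_. borel) \<rightarrow>\<^sub>M PiM {1..m} (\<lambda>_. borel)"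
    by (intro measurable_restrict measurable_component_singleton) auto
  ultimately have "indep_var (PiM {1..m} (\<lambda>_. borel)) (?f \<circ> ?X ?A) (PiM {1..m} (\<lambda>_. borel)) (?g \<circ> ?X ?B)"
    by (rule indep_var_compose)
  moreover have "?f \<circ> ?X ?A = residual_vector k"
    by (auto simp: fun_eq_iff residual_vector_def restrict_def curry_def intro!: greedy_residual_cong)
  moreover have "?g \<circ> ?X ?B = gaussian_column (Suc k)"
    by (auto simp: fun_eq_iff gaussian_column_def)
  ultimately show ?thesis by simp
qed

lemma nn_integral_abs_residual_column:
  assumes "k < n"
  shows "(\<integral>\<^sup>+\<omega>. ennreal \<bar>\<Sum>i=1..m. greedy_residual m (H \<omega>) k i * H \<omega> i (Suc k)\<bar> \<partial>M)
    = (\<integral>\<^sup>+\<omega>. ennreal (sqrt (2 / pi) * L2_set (greedy_residual m (H \<omega>) k) {1..m}) \<partial>M)"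
proof -
  define h :: "(nat \<Rightarrow> real) \<times> (nat \<Rightarrow> real) \<Rightarrow> ennreal" where "h p = ennreal \<bar>\<Sum>i=1..m. fst p i * snd p i\<bar>" for p
  have "h \<in> borel_measurable (PiM {1..m} (\<lambda>_. borel) \<Otimes>\<^sub>M PiM {1..m} (\<lambda>_. borel))"
    unfolding h_def by measurable
  from nn_integral_indep_var[OF residual_indep_column[OF assms] this]
  have "(\<integral>\<^sup>+\<omega>. ennreal \<bar>\<Sum>i=1..m. greedy_residual m (H \<omega>) k i * H \<omega> i (Suc k)\<bar> \<partial>M)
    = (\<integral>\<^sup>+\<omega>. \<integral>\<^sup>+\<omega>'. ennreal \<bar>\<Sum>i=1..m. greedy_residual m (H \<omega>) k i * H \<omega>' i (Suc k)\<bar> \<partial>M \<partial>M)"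
    by (simp add: h_def residual_vector_def gaussian_column_def)
  also have "\<dots> = (\<integral>\<^sup>+\<omega>. ennreal (sqrt (2 / pi) * L2_set (greedy_residual m (H \<omega>) k) {1..m}) \<partial>M)"
    using assms by (intro nn_integral_cong nn_integral_abs_column_combination) auto
  finally show ?thesis .
qed

text \<open>The first component can only vanish if the first entry of the new column is plus or minus the first
  component of the previous residual, of which it is independent.\<close>
lemma AE_residual_nonzero:
  assumes "k < n" "m > 0"
  shows "AE \<omega> in M. greedy_residual m (H \<omega>) (Suc k) 1 \<noteq> 0"
proof -
  have one: "1 \<in> {1..m}" using assms by auto
  have "AE \<omega> in M. snd (residual_vector k \<omega>, gaussian_column (Suc k) \<omega>) 1 \<noteq> fst (residual_vector k \<omega>, gaussian_column (Suc k) \<omega>) 1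
      \<and> snd (residual_vector k \<omega>, gaussian_column (Suc k) \<omega>) 1 \<noteq> - fst (residual_vector k \<omega>, gaussian_column (Suc k) \<omega>) 1"
  proof (rule AE_indep_var[OF residual_indep_column[OF assms(1)]])
    show "Measurable.pred (PiM {1..m} (\<lambda>_. borel) \<Otimes>\<^sub>M PiM {1..m} (\<lambda>_. borel))
      (\<lambda>p. snd p 1 \<noteq> (fst p 1 :: real) \<and> snd p 1 \<noteq> - fst p 1)"
      using one by measurable
    have "AE \<omega>' in M. H \<omega>' 1 (Suc k) \<noteq> c" for c
      using assms one by (intro distributed_lborel_AE_neq[OF entries_std_normal]) auto
    then have "AE \<omega>' in M. gaussian_column (Suc k) \<omega>' 1 \<noteq> c \<and> gaussian_column (Suc k) \<omega>' 1 \<noteq> - c" for c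
      using one by (simp add: gaussian_column_def AE_conj_iff)
    then show "AE \<omega> in M. AE \<omega>' in M. snd (residual_vector k \<omega>, gaussian_column (Suc k) \<omega>') 1 \<noteq> fst (residual_vector k \<omega>, gaussian_column (Suc k) \<omega>') 1
      \<and> snd (residual_vector k \<omega>, gaussian_column (Suc k) \<omega>') 1 \<noteq> - fst (residual_vector k \<omega>, gaussian_column (Suc k) \<omega>') 1"
      by simp
  qed
  then show ?thesis
    by eventually_elim (use one in \<open>auto simp: residual_vector_def gaussian_column_def\<close>)
qed

text \<open>Given a nonzero residual, its inner product with the next column is a nondegenerate normal
  variable.\<close>
lemma AE_no_tie:
  assumes "k \<in> {1..<n}" "m > 0"
  shows "AE \<omega> in M. (\<Sum>i=1..m. greedy_residual m (H \<omega>) k i * H \<omega> i (Suc k)) \<noteq> 0"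
proof -
  have "AE \<omega> in M. (\<Sum>i=1..m. fst (residual_vector k \<omega>, gaussian_column (Suc k) \<omega>) i * snd (residual_vector k \<omega>, gaussian_column (Suc k) \<omega>) i) \<noteq> 0"
  proof (rule AE_indep_var[OF residual_indep_column])
    show "k < n" using assms by simp
    show "Measurable.pred (PiM {1..m} (\<lambda>_. borel) \<Otimes>\<^sub>M PiM {1..m} (\<lambda>_. borel))
      (\<lambda>p. (\<Sum>i=1..m. fst p i * (snd p i :: real)) \<noteq> 0)"
      by measurable
    have "AE \<omega> in M. greedy_residual m (H \<omega>) k 1 \<noteq> 0"
    proof -
      have "k - 1 < n" and k: "Suc (k - 1) = k" using assms by auto
      then show ?thesis using AE_residual_nonzero[of "k - 1"] assms(2) unfolding k by blast
    qed
    then show "AE \<omega> in M. AE \<omega>' in M.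
      (\<Sum>i=1..m. fst (residual_vector k \<omega>, gaussian_column (Suc k) \<omega>') i * snd (residual_vector k \<omega>, gaussian_column (Suc k) \<omega>') i) \<noteq> 0"
    proof eventually_elim
      case (elim \<omega>)
      then have "\<exists>i\<in>{1..m}. greedy_residual m (H \<omega>) k i \<noteq> 0" using assms by force
      then show ?case
        using distributed_lborel_AE_neq[OF column_combination_normal[of "Suc k" "greedy_residual m (H \<omega>) k"], of 0] assms
        by (simp add: residual_vector_def gaussian_column_def)
    qed
  qed
  then show ?thesis by (simp add: residual_vector_def gaussian_column_def)
qed

end

section \<open>The recursion for the expected residuals\<close>

context greedy_run
begin

abbreviation r :: "nat \<Rightarrow> 'w \<Rightarrow> real" where
  "r k \<omega> \<equiv> sq_norm_cols m (H \<omega>) k (x \<omega>)"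

lemma r_nonneg: "r k \<omega> \<ge> 0"
  by (simp add: sq_norm_cols_def)

lemma r_measurable: "k \<le> n \<Longrightarrow> random_variable borel (r k)"
  unfolding sq_norm_cols_eq_sum
  by (intro borel_measurable_sum borel_measurable_power borel_measurable_times entry_measurable signs_measurable) auto

text \<open>Outside the null set of ties the signs of the run coincide with those of the fixed rule.\<close>
lemma AE_partial_sums_eq_residual:
  assumes "m > 0"
  shows "AE \<omega> in M. \<forall>k\<le>n. \<forall>i. (\<Sum>j=1..k. H \<omega> i j * x \<omega> j) = greedy_residual m (H \<omega>) k i"
proof -
  have "AE \<omega> in M. \<forall>k\<in>{1..<n}. (\<Sum>i=1..m. greedy_residual m (H \<omega>) k i * H \<omega> i (Suc k)) \<noteq> 0"
    using assms by (intro AE_finite_allI AE_no_tie) auto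
  then show ?thesis
    using AE_space by eventually_elim (use greedy_residual_eq[OF signs_greedy] in blast)
qed

text \<open>The cross term only lowers the norm, so \<open>r (k + 1)\<close> is dominated by \<open>r k + \<parallel>w\<parallel>\<^sup>2\<close>.\<close>
lemma r_integrable: "k \<le> n \<Longrightarrow> integrable M (r k)"
proof (induction k)
  case 0
  then show ?case by (simp add: sq_norm_cols_eq_sum)
next
  case (Suc k)
  have "integrable M (\<lambda>\<omega>. r k \<omega> + (\<Sum>i=1..m. (H \<omega> i (Suc k))\<^sup>2))"
    using Suc by (intro Bochner_Integration.integrable_add Bochner_Integration.integrable_sum entry_square) auto
  then show ?case
  proof (rule Bochner_Integration.integrable_bound)
    show "AE \<omega> in M. norm (r (Suc k) \<omega>) \<le> norm (r k \<omega> + (\<Sum>i=1..m. (H \<omega> i (Suc k))\<^sup>2))"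
      using AE_space
    proof eventually_elim
      case (elim \<omega>)
      then show ?case
        using greedy_norm_Suc[OF signs_greedy[OF elim], of k] r_nonneg[of \<omega> "Suc k"] Suc.prems by simp
    qed
  qed (use Suc.prems in \<open>intro r_measurable\<close>)
qed

lemma expectation_r_Suc:
  assumes "k < n" "m > 0"
  shows "expectation (r (Suc k)) =
    expectation (r k) - 2 * sqrt (2 / pi) * expectation (\<lambda>\<omega>. sqrt (r k \<omega>)) + real m"
proof -
  define w where "w \<omega> = \<bar>\<Sum>i=1..m. (\<Sum>j=1..k. H \<omega> i j * x \<omega> j) * H \<omega> i (Suc k)\<bar>" for \<omega>
  define c where "c \<omega> = (\<Sum>i=1..m. (H \<omega> i (Suc k))\<^sup>2)" for \<omega>
  have w_nonneg: "0 \<le> w \<omega>" for \<omega> by (simp add: w_def)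
  have [measurable]: "random_variable borel w"
    unfolding w_def using assms
    by (intro borel_measurable_abs borel_measurable_sum borel_measurable_times entry_measurable signs_measurable) auto
  have [measurable]: "random_variable borel (r k)" using assms by (intro r_measurable) auto
  have step: "r (Suc k) \<omega> = r k \<omega> + c \<omega> - 2 * w \<omega>" if "\<omega> \<in> space M" for \<omega>
    unfolding w_def c_def using greedy_norm_Suc[OF signs_greedy[OF that] assms(1)] .
  have c: "integrable M c" "expectation c = real m"
    unfolding c_def using assms
    by (auto simp: Bochner_Integration.integral_sum entry_square intro!: Bochner_Integration.integrable_sum)
  have rk: "integrable M (r k)" "integrable M (r (Suc k))" using assms by (auto intro: r_integrable)
  have "integrable M (\<lambda>\<omega>. (r k \<omega> + c \<omega> - r (Suc k) \<omega>) / 2)"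
    using rk c by auto
  then have w: "integrable M w"
    by (rule Bochner_Integration.integrable_cong[THEN iffD1, OF refl, rotated]) (simp add: step)
  have sqrt_r: "sqrt (r k \<omega>) = L2_set (\<lambda>i. \<Sum>j=1..k. H \<omega> i j * x \<omega> j) {1..m}" for \<omega>
    by (simp add: sq_norm_cols_def)
  have "(\<integral>\<^sup>+\<omega>. ennreal (w \<omega>) \<partial>M) = (\<integral>\<^sup>+\<omega>. ennreal \<bar>\<Sum>i=1..m. greedy_residual m (H \<omega>) k i * H \<omega> i (Suc k)\<bar> \<partial>M)"
    using AE_partial_sums_eq_residual[OF assms(2)] assms(1)
    by (intro nn_integral_cong_AE) (auto simp: w_def)
  also have "\<dots> = (\<integral>\<^sup>+\<omega>. ennreal (sqrt (2 / pi) * L2_set (greedy_residual m (H \<omega>) k) {1..m}) \<partial>M)"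
    by (rule nn_integral_abs_residual_column[OF assms(1)])
  also have "\<dots> = (\<integral>\<^sup>+\<omega>. ennreal (sqrt (2 / pi) * sqrt (r k \<omega>)) \<partial>M)"
    using AE_partial_sums_eq_residual[OF assms(2)] assms(1)
    by (intro nn_integral_cong_AE) (auto simp: sqrt_r)
  finally have "expectation w = expectation (\<lambda>\<omega>. sqrt (2 / pi) * sqrt (r k \<omega>))"
    by (subst (1 2) integral_eq_nn_integral) (auto simp: w_nonneg r_nonneg)
  moreover have "expectation (r (Suc k)) = expectation (\<lambda>\<omega>. r k \<omega> + c \<omega> - 2 * w \<omega>)"
    by (intro Bochner_Integration.integral_cong) (auto simp: step)
  ultimately show ?thesis
    using rk c w by simp
qed

lemma expectation_r_0: "expectation (r 0) = 0"
  by (simp add: sq_norm_cols_eq_sum)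

lemma expectation_r_bounds:
  assumes "k \<le> n" "m > 0"
  shows "0 \<le> expectation (r k)" "expectation (r k) \<le> real m * real k"
proof -
  show "0 \<le> expectation (r k)"
    by (simp add: r_nonneg integral_nonneg_AE)
  show "expectation (r k) \<le> real m * real k"
    using assms(1)
  proof (induction k)
    case (Suc k)
    have "0 \<le> expectation (\<lambda>\<omega>. sqrt (r k \<omega>))" by (simp add: r_nonneg integral_nonneg_AE)
    then have "0 \<le> 2 * sqrt (2 / pi) * expectation (\<lambda>\<omega>. sqrt (r k \<omega>))" by simp
    then show ?case
      using expectation_r_Suc[of k] Suc assms(2) by (simp add: algebra_simps)
  qed (simp add: expectation_r_0)
qed

text \<open>A bound uniform in \<open>n\<close> is what dominated convergence needs; it follows pointwise from
  \<open>2 s \<le> s\<^sup>2 + 1\<close> with \<open>s = sqrt r / n\<close>.\<close>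
lemma expectation_sqrt_r_le:
  assumes "k \<le> n"
  shows "expectation (\<lambda>\<omega>. sqrt (r k \<omega>)) / real n \<le> (expectation (r k) / (real n)\<^sup>2 + 1) / 2"
proof (cases "n = 0")
  case False
  have amgm: "sqrt t * 2 / real n \<le> t / (real n)\<^sup>2 + 1" if "t \<ge> 0" for t
  proof -
    have "0 \<le> (sqrt t / real n - 1)\<^sup>2" by simp
    also have "\<dots> = t / (real n)\<^sup>2 + 1 - 2 * (sqrt t / real n)"
      using that by (simp add: power2_diff power_divide)
    finally show ?thesis by (simp add: mult.commute)
  qed
  have [measurable]: "random_variable borel (r k)" using assms by (rule r_measurable)
  have int: "integrable M (\<lambda>\<omega>. (r k \<omega> / (real n)\<^sup>2 + 1) / 2)"
    using r_integrable[OF assms] by auto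
  have "integrable M (\<lambda>\<omega>. sqrt (r k \<omega>) / real n)"
    using int by (rule Bochner_Integration.integrable_bound) (auto simp: r_nonneg amgm)
  then have "expectation (\<lambda>\<omega>. sqrt (r k \<omega>) / real n) \<le> expectation (\<lambda>\<omega>. (r k \<omega> / (real n)\<^sup>2 + 1) / 2)"
    using int by (rule integral_mono) (simp add: amgm r_nonneg)
  then show ?thesis
    using r_integrable[OF assms] by (simp add: prob_space)
qed simp

section \<open>Comparison with the deterministic sequence\<close>

text \<open>Replacing \<open>E (sqrt r)\<close> by \<open>sqrt (E r)\<close> in the recursion for the means costs \<open>h \<delta>\<close> per step, with step size \<open>h = 2 sqrt (2 / pi) / n\<close>; the
  stability estimate adds these up, and \<open>8 / pi / n\<close> is its accumulated discretisation error \<open>n h\<^sup>2\<close>.\<close>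
lemma expectation_r_close_phi:
  assumes "n > 0" "m > 0" "real m = \<alpha> * real n"
  defines "\<delta> k \<equiv> expectation (\<lambda>\<omega>. sqrt (r k \<omega>)) / real n - sqrt (expectation (r k)) / real n"
  shows "\<bar>expectation (r n) / (real n)\<^sup>2 - phi (real m) n / (real n)\<^sup>2\<bar>
    \<le> 2 * sqrt (2 / pi) * ((\<Sum>k=1..n. \<bar>\<delta> k\<bar>) / real n) + 8 / pi / real n"
proof -
  let ?c = "sqrt (2 / pi)" and ?h = "2 * sqrt (2 / pi) / real n"
  have "\<bar>expectation (r n) / (real n)\<^sup>2 - phi (real m) n / (real n)\<^sup>2\<bar> \<le> (\<Sum>k<n. ?h * \<bar>\<delta> k\<bar>) + real n * ?h\<^sup>2"
  proof (rule sqrt_recursion_stable[where a = "\<lambda>k. expectation (r k) / (real n)\<^sup>2"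
        and b = "\<lambda>k. phi (real m) k / (real n)\<^sup>2" and g = "\<alpha> / real n"])
    fix k assume "k < n"
    let ?E = "expectation (r k)" and ?R = "expectation (\<lambda>\<omega>. sqrt (r k \<omega>))"
    have "expectation (r (Suc k)) / (real n)\<^sup>2 = ?E / (real n)\<^sup>2 - ?h * (?R / real n) + \<alpha> / real n"
      unfolding expectation_r_Suc[OF \<open>k < n\<close> assms(2)] using assms(1,3)
      by (simp add: add_divide_distrib diff_divide_distrib power2_eq_square)
    moreover have "sqrt (?E / (real n)\<^sup>2) = sqrt ?E / real n"
      by (simp add: real_sqrt_divide)
    moreover have cancel: "(a - p + g) - (a - q + g) = - (p - q)" for a p q g :: real
      by simp
    ultimately have "expectation (r (Suc k)) / (real n)\<^sup>2
        - (?E / (real n)\<^sup>2 - ?h * sqrt (?E / (real n)\<^sup>2) + \<alpha> / real n) = - (?h * \<delta> k)"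
      unfolding \<delta>_def right_diff_distrib by (simp only: cancel)
    then show "\<bar>expectation (r (Suc k)) / (real n)\<^sup>2
        - (?E / (real n)\<^sup>2 - ?h * sqrt (?E / (real n)\<^sup>2) + \<alpha> / real n)\<bar> \<le> ?h * \<bar>\<delta> k\<bar>"
      by (simp only: abs_minus_cancel abs_mult) simp
    show "phi (real m) (Suc k) / (real n)\<^sup>2
        = phi (real m) k / (real n)\<^sup>2 - ?h * sqrt (phi (real m) k / (real n)\<^sup>2) + \<alpha> / real n"
      by (rule scaled_phi_Suc[OF assms(1,3)])
  qed (use assms phi_nonneg[of "real m"] expectation_r_bounds(1) in \<open>auto simp: expectation_r_0\<close>)
  also have "(\<Sum>k<n. ?h * \<bar>\<delta> k\<bar>) \<le> (\<Sum>k=1..n. ?h * \<bar>\<delta> k\<bar>)"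
  proof -
    have "\<delta> 0 = 0" by (simp add: \<delta>_def sq_norm_cols_eq_sum)
    then have "(\<Sum>k<n. ?h * \<bar>\<delta> k\<bar>) = (\<Sum>k=1..<n. ?h * \<bar>\<delta> k\<bar>)"
      by (intro sum.mono_neutral_right) (auto simp: Suc_le_eq)
    also have "\<dots> \<le> (\<Sum>k=1..n. ?h * \<bar>\<delta> k\<bar>)"
      by (rule sum_mono2) auto
    finally show ?thesis .
  qed
  also have "(\<Sum>k=1..n. ?h * \<bar>\<delta> k\<bar>) = 2 * ?c * ((\<Sum>k=1..n. \<bar>\<delta> k\<bar>) / real n)"
    by (simp add: sum_distrib_left sum_divide_distrib)
  also have "real n * ?h\<^sup>2 = 8 / pi / real n"
    using assms(1) by (simp add: power_divide power_mult_distrib power2_eq_square[of "real n"])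
  finally show ?thesis by simp
qed

end

lemma admissible_sizes_pos:
  assumes "n \<in> admissible_sizes \<alpha>" "real m = \<alpha> * real n"
  shows "n > 0" "m > 0"
  using assms by (auto simp: admissible_sizes_def intro: gr0I)

theorem mainTheorem6:
  fixes \<alpha> :: real
    and m :: "nat \<Rightarrow> nat"
    and M :: "nat \<Rightarrow> 'w measure"
    and H :: "nat \<Rightarrow> 'w \<Rightarrow> nat \<Rightarrow> nat \<Rightarrow> real"
    and x :: "nat \<Rightarrow> 'w \<Rightarrow> nat \<Rightarrow> real"
    and r :: "nat \<Rightarrow> nat \<Rightarrow> 'w \<Rightarrow> real"
  assumes alpha_pos: "\<alpha> > 0"
    and rows: "\<And>n. n \<in> admissible_sizes \<alpha> \<Longrightarrow> real (m n) = \<alpha> * real n"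
    and run: "\<And>n. n \<in> admissible_sizes \<alpha> \<Longrightarrow> greedy_run (M n) (m n) n (H n) (x n)"
    and r_eq: "\<And>n k \<omega>. r n k \<omega> = sq_norm_cols (m n) (H n \<omega>) k (x n \<omega>)"
  shows
    "(\<forall>n\<in>admissible_sizes \<alpha>. \<forall>k\<in>{2..n}.
        (\<integral>\<omega>. r n k \<omega> \<partial>M n) =
          (\<integral>\<omega>. r n (k - 1) \<omega> \<partial>M n)
          - 2 * sqrt (2 / pi) * (\<integral>\<omega>. sqrt (r n (k - 1) \<omega>) \<partial>M n) + real (m n))
     \<and> ((\<forall>c. 0 < c \<and> c \<le> 1 \<longrightarrow>
           ((\<lambda>n. (\<integral>\<omega>. sqrt (r n (nat \<lceil>c * real n\<rceil>) \<omega>) \<partial>M n) / real n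
                 - sqrt (\<integral>\<omega>. r n (nat \<lceil>c * real n\<rceil>) \<omega> \<partial>M n) / real n) \<longlongrightarrow> 0)
             (admissible_at_top \<alpha>))
        \<longrightarrow> (\<exists>L. ((\<lambda>n. (\<integral>\<omega>. r n n \<omega> \<partial>M n) / (real n)\<^sup>2) \<longlongrightarrow> L) (admissible_at_top \<alpha>)
               \<and> ((\<lambda>n. phi (real (m n)) n / (real n)\<^sup>2) \<longlongrightarrow> L) (admissible_at_top \<alpha>)))"
proof (intro conjI ballI impI)
  fix n k :: nat
  assume n: "n \<in> admissible_sizes \<alpha>" and k: "k \<in> {2..n}"
  interpret greedy_run "M n" "m n" n "H n" "x n" by (rule run[OF n])
  have "k - 1 < n" "Suc (k - 1) = k" using k by auto
  show "(\<integral>\<omega>. r n k \<omega> \<partial>M n) = (\<integral>\<omega>. r n (k - 1) \<omega> \<partial>M n)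
      - 2 * sqrt (2 / pi) * (\<integral>\<omega>. sqrt (r n (k - 1) \<omega>) \<partial>M n) + real (m n)"
    using expectation_r_Suc[OF \<open>k - 1 < n\<close> admissible_sizes_pos(2)[OF n rows[OF n]]] \<open>Suc (k - 1) = k\<close>
    by (simp add: r_eq)
next
  assume concentration: "\<forall>c. 0 < c \<and> c \<le> 1 \<longrightarrow>
     ((\<lambda>n. (\<integral>\<omega>. sqrt (r n (nat \<lceil>c * real n\<rceil>) \<omega>) \<partial>M n) / real n
         - sqrt (\<integral>\<omega>. r n (nat \<lceil>c * real n\<rceil>) \<omega> \<partial>M n) / real n) \<longlongrightarrow> 0) (admissible_at_top \<alpha>)"
  note pos = admissible_sizes_pos[OF _ rows]
  have r_fun: "r n k = (\<lambda>\<omega>. sq_norm_cols (m n) (H n \<omega>) k (x n \<omega>))" for n k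
    by (simp add: fun_eq_iff r_eq)
  \<comment> \<open>Extending by 0 off the admissible sizes turns the filter into the ordinary sequential limit,
    to which dominated convergence applies.\<close>
  define \<delta> where "\<delta> n k = (if n \<in> admissible_sizes \<alpha>
      then (\<integral>\<omega>. sqrt (r n k \<omega>) \<partial>M n) / real n - sqrt (\<integral>\<omega>. r n k \<omega> \<partial>M n) / real n else 0)" for n k
  have bound: "\<bar>\<delta> n k\<bar> \<le> (\<alpha> + 1) / 2 + sqrt \<alpha>" if "k \<le> n" for n k
  proof (cases "n \<in> admissible_sizes \<alpha>")
    case True
    interpret greedy_run "M n" "m n" n "H n" "x n" by (rule run[OF True])
    let ?E = "\<integral>\<omega>. r n k \<omega> \<partial>M n" and ?R = "\<integral>\<omega>. sqrt (r n k \<omega>) \<partial>M n"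
    have "?E \<le> real (m n) * real k" "0 \<le> ?E"
      using expectation_r_bounds[OF that pos(2)[OF True True]] by (simp_all add: r_eq)
    moreover have "real (m n) * real k \<le> \<alpha> * (real n)\<^sup>2"
      using that rows[OF True] alpha_pos by (simp add: power2_eq_square mult_left_mono)
    ultimately have E: "?E / (real n)\<^sup>2 \<le> \<alpha>"
      using pos(1)[OF True True] by (simp add: divide_le_eq)
    have "?R / real n \<le> (?E / (real n)\<^sup>2 + 1) / 2"
      using expectation_sqrt_r_le[OF that] by (simp add: r_eq)
    then have R: "?R / real n \<le> (\<alpha> + 1) / 2" "0 \<le> ?R / real n"
      using E r_nonneg by (auto simp: r_eq intro!: integral_nonneg_AE divide_nonneg_nonneg)
    have "sqrt ?E / real n = sqrt (?E / (real n)\<^sup>2)" by (simp add: real_sqrt_divide)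
    then have S: "sqrt ?E / real n \<le> sqrt \<alpha>" "0 \<le> sqrt ?E / real n"
      using E \<open>0 \<le> ?E\<close> by auto
    show ?thesis using R S unfolding \<delta>_def if_P[OF True] by linarith
  next
    case False
    then show ?thesis using alpha_pos by (simp add: \<delta>_def)
  qed
  have "(\<lambda>n. \<delta> n (nat \<lceil>c * real n\<rceil>)) \<longlonglongrightarrow> 0" if "0 < c" "c \<le> 1" for c
    using concentration that
    by (auto simp: tendsto_iff admissible_at_top_def eventually_inf_principal \<delta>_def
        intro: eventually_mono)
  from mean_tendsto_0[where f = \<delta>, OF bound this]
  have "(\<lambda>n. 2 * sqrt (2 / pi) * ((\<Sum>k=1..n. \<bar>\<delta> n k\<bar>) / real n) + 8 / pi / real n) \<longlonglongrightarrow> 2 * sqrt (2 / pi) * 0 + 0"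
    by (intro tendsto_add tendsto_mult tendsto_const lim_const_over_n)
  then have small: "((\<lambda>n. 2 * sqrt (2 / pi) * ((\<Sum>k=1..n. \<bar>\<delta> n k\<bar>) / real n) + 8 / pi / real n) \<longlongrightarrow> 0)
      (admissible_at_top \<alpha>)"
    by (auto simp: admissible_at_top_def intro: tendsto_mono[OF inf_le1])
  have admissible: "\<forall>\<^sub>F n in admissible_at_top \<alpha>. n \<in> admissible_sizes \<alpha>"
    by (simp add: admissible_at_top_def eventually_inf_principal)
  obtain L D where L: "\<And>n \<mu>. n > 0 \<Longrightarrow> \<mu> = \<alpha> * real n \<Longrightarrow> \<mu> \<ge> 1 \<Longrightarrow> \<bar>phi \<mu> n / (real n)\<^sup>2 - L\<bar> \<le> D / real n"
    using phi_scaling_limit[OF alpha_pos] by blast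
  have "((\<lambda>n. D / real n) \<longlongrightarrow> 0) (admissible_at_top \<alpha>)"
    unfolding admissible_at_top_def by (rule tendsto_mono[OF inf_le1 lim_const_over_n])
  moreover have "\<forall>\<^sub>F n in admissible_at_top \<alpha>. norm (phi (real (m n)) n / (real n)\<^sup>2 - L) \<le> D / real n"
    using admissible by eventually_elim (use L rows pos in \<open>force simp: Suc_le_eq\<close>)
  ultimately have "((\<lambda>n. phi (real (m n)) n / (real n)\<^sup>2 - L) \<longlongrightarrow> 0) (admissible_at_top \<alpha>)"
    by (rule Lim_null_comparison[rotated])
  then have phi_lim: "((\<lambda>n. phi (real (m n)) n / (real n)\<^sup>2) \<longlongrightarrow> L) (admissible_at_top \<alpha>)"
    by (rule LIM_zero_cancel)
  have "\<forall>\<^sub>F n in admissible_at_top \<alpha>. norm ((\<integral>\<omega>. r n n \<omega> \<partial>M n) / (real n)\<^sup>2 - phi (real (m n)) n / (real n)\<^sup>2)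
      \<le> 2 * sqrt (2 / pi) * ((\<Sum>k=1..n. \<bar>\<delta> n k\<bar>) / real n) + 8 / pi / real n"
    using admissible
  proof eventually_elim
    case (elim n)
    interpret greedy_run "M n" "m n" n "H n" "x n" by (rule run[OF elim])
    show ?case
      using expectation_r_close_phi[OF pos[OF elim elim] rows[OF elim]] elim by (simp add: \<delta>_def r_fun)
  qed
  then have "((\<lambda>n. (\<integral>\<omega>. r n n \<omega> \<partial>M n) / (real n)\<^sup>2 - phi (real (m n)) n / (real n)\<^sup>2) \<longlongrightarrow> 0)
      (admissible_at_top \<alpha>)"
    using small by (rule Lim_null_comparison)
  from tendsto_add[OF this phi_lim]
  have "((\<lambda>n. (\<integral>\<omega>. r n n \<omega> \<partial>M n) / (real n)\<^sup>2) \<longlongrightarrow> L) (admissible_at_top \<alpha>)"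
    by simp
  with phi_lim show "\<exists>L. ((\<lambda>n. (\<integral>\<omega>. r n n \<omega> \<partial>M n) / (real n)\<^sup>2) \<longlongrightarrow> L) (admissible_at_top \<alpha>)
      \<and> ((\<lambda>n. phi (real (m n)) n / (real n)\<^sup>2) \<longlongrightarrow> L) (admissible_at_top \<alpha>)"
    by blast
qed

end
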